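(* Let $Y$ be a finite dimensional Euclidean space, $K\subseteq Y$ a closed convex cone and $H\subseteq Y$ an affine subspace. The following hold for the system $H\cap K$. (1) If $H\cap K$ is infeasible, then there is an affine subspace $H'\supseteq H$ such that $\operatorname{codim}H'\le\ell_K$ and $H'\cap K$ is infeasible. (2) If $H\cap K$ is not strongly infeasible, then there is an affine subspace $H''\subseteq H$ such that $\dim H''\le\ell_{K^*}-1$ and $H''\cap K$ is not strongly infeasible. (3) If $H\cap K$ is weakly infeasible, then there are affine subspaces $H''\subseteq H\subseteq H'$ with $\operatorname{codim}H'\le\ell_K$ and $\dim H''\le\ell_{K^*}-1$ such that $H'\cap K$ and $H''\cap K$ are both weakly infeasible.
   Context: $K^*=\{y\in Y:\langle y,x\rangle\ge0\ \forall x\in K\}$. The codimension of a set is $\dim Y$ minus its dimension. A convex subset $F$ of a closed convex cone $C$ is a face of $C$ if $y,z\in C$, $\frac12(y+z)\in F$ imply $y,z\in F$; $\ell_C$ is the largest $k$ such that there are nonempty faces $F_1\subsetneq\dots\subsetneq F_k$ of $C$. Feasibility status: affine subspaces are nonempty. The system $H\cap K$ is infeasible if $H\cap K=\emptyset$. Its strong and weak infeasibility are those of a representation of the system in primal form ($H=\{b-Ax:x\in\mathbb{R}^m\}$, with constraint $b-Ax\in K$; strongly infeasible if some $y\in K^*$ satisfies $A^*y=0$, $\langle b,y\rangle=-1$) or in dual form ($H=\{y: A^*y=c\}$, with constraint $y\in K$; strongly infeasible if some $x$ satisfies $Ax\in K^*$, $\langle c,x\rangle=-1$). Equivalently: $H\cap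 K$ is strongly infeasible if there is $y\in K^*$ with $\langle y,h\rangle=-1$ for all $h\in H$. It is weakly infeasible if it is infeasible but not strongly infeasible. *)

theory Defs
  imports "HOL-Analysis.Analysis"
begin

definition affine_subspace :: "'a::real_vector set \<Rightarrow> bool" where
  "affine_subspace S \<longleftrightarrow> affine S \<and> S \<noteq> {}"

definition codim :: "'a::euclidean_space set \<Rightarrow> int" where
  "codim S = int DIM('a) - aff_dim S"

definition dual_cone :: "'a::real_inner set \<Rightarrow> 'a set" where
  "dual_cone K = {y. \<forall>x\<in>K. 0 \<le> y \<bullet> x}"

definition face_chain :: "'a::real_vector set \<Rightarrow> nat \<Rightarrow> (nat \<Rightarrow> 'a set) \<Rightarrow> bool" where
  "face_chain C k F \<longleftrightarrow>
     (\<forall>i\<in>{1..k}. F i face_of C \<and> F i \<noteq> {}) \<and> (\<forall>i\<in>{1..<k}. F i \<subset> F (Suc i))"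

definition max_face_chain :: "'a::real_vector set \<Rightarrow> nat" where
  "max_face_chain C = (GREATEST k. \<exists>F. face_chain C k F)"

definition strongly_infeasible :: "'a::real_inner set \<Rightarrow> 'a set \<Rightarrow> bool" where
  "strongly_infeasible H K \<longleftrightarrow> (\<exists>y\<in>dual_cone K. \<forall>h\<in>H. y \<bullet> h = -1)"

definition weakly_infeasible :: "'a::real_inner set \<Rightarrow> 'a set \<Rightarrow> bool" where
  "weakly_infeasible H K \<longleftrightarrow> H \<inter> K = {} \<and> \<not> strongly_infeasible H K"

text \<open>For convex sets, the library's faces are those given by the midpoint condition.\<close>

lemma face_of_iff_midpoint:
  fixes C :: "'a::euclidean_space set"
  assumes "convex C"
  shows "F face_of C \<longleftrightarrow>
    F \<subseteq> C \<and> convex F \<and> (\<forall>y\<in>C. \<forall>z\<in>C. (1/2) *\<^sub>R (y + z) \<in> F \<longrightarrow> y \<in> F \<and> z \<in> F)"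
    (is "_ \<longleftrightarrow> _ \<and> _ \<and> ?mid")
proof (intro iffI conjI)
  assume F: "F face_of C"
  then show "F \<subseteq> C" "convex F"
    by (auto simp: face_of_def)
  show ?mid
  proof (intro ballI impI)
    fix y z assume yz: "y \<in> C" "z \<in> C" "(1/2) *\<^sub>R (y + z) \<in> F"
    show "y \<in> F \<and> z \<in> F"
    proof (cases "y = z")
      case True
      with yz show ?thesis by (simp flip: scaleR_2)
    next
      case False
      then have "midpoint y z \<in> open_segment y z" by simp
      with F yz show ?thesis by (auto simp: face_of_def midpoint_def)
    qed
  qed
next
  assume R: "F \<subseteq> C \<and> convex F \<and> ?mid"
  have reach: "y \<in> F"
    if "y \<in> C" "z \<in> C" "0 < t" "t \<le> 1" "(1 - t) *\<^sub>R y + t *\<^sub>R z \<in> F" "2^n * (1 - t) \<ge> 1"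
    for y z t and n :: nat
    using that
  proof (induction n arbitrary: t)
    case 0
    then show ?case by simp
  next
    case (Suc n)
    show ?case
    proof (cases "t \<le> 1/2")
      case True
      have "(1 - 2*t) *\<^sub>R y + (2*t) *\<^sub>R z \<in> C"
        using assms Suc.prems True by (intro convexD) auto
      moreover have "(1/2) *\<^sub>R (y + ((1 - 2*t) *\<^sub>R y + (2*t) *\<^sub>R z)) = (1 - t) *\<^sub>R y + t *\<^sub>R z"
        by (simp add: algebra_simps flip: scaleR_add_left)
      ultimately show ?thesis using R Suc.prems by metis
    next
      case False
      let ?s = "2*t - 1"
      have C: "(1 - ?s) *\<^sub>R y + ?s *\<^sub>R z \<in> C"
        using assms Suc.prems False by (intro convexD) auto
      have "(1/2) *\<^sub>R (((1 - ?s) *\<^sub>R y + ?s *\<^sub>R z) + z) = (1 - t) *\<^sub>R y + t *\<^sub>R z"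
        by (simp add: algebra_simps flip: scaleR_add_left)
      then have "(1 - ?s) *\<^sub>R y + ?s *\<^sub>R z \<in> F"
        using R C Suc.prems by metis
      moreover have "2 ^ n * (1 - ?s) \<ge> 1"
        using Suc.prems by (simp add: algebra_simps)
      ultimately show ?thesis
        using Suc.IH[of ?s] Suc.prems False by auto
    qed
  qed
  have reach': "y \<in> F" if "y \<in> C" "z \<in> C" "0 < t" "t < 1" "(1 - t) *\<^sub>R y + t *\<^sub>R z \<in> F" for y z t
  proof -
    obtain n where n: "1 / (1 - t) < 2 ^ n"
      using real_arch_pow[of 2 "1 / (1 - t)"] by auto
    then have "2 ^ n * (1 - t) \<ge> 1"
      using that by (simp add: field_simps)
    then show ?thesis using reach[of y z t n] that by auto
  qed
  show "F face_of C"
    unfolding face_of_def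
  proof (intro conjI ballI impI)
    show "F \<subseteq> C" "convex F" using R by auto
    fix y z x assume yz: "y \<in> C" "z \<in> C" "x \<in> F" "x \<in> open_segment y z"
    then obtain t where t: "0 < t" "t < 1" "x = (1 - t) *\<^sub>R y + t *\<^sub>R z"
      by (auto simp: in_segment)
    show "y \<in> F" using reach'[of y z t] yz t by auto
    show "z \<in> F" using reach'[of z y "1 - t"] yz t by (auto simp: add.commute)
  qed
qed

text \<open>Face chains have bounded length, so the maximum in \<open>max_face_chain\<close> is attained.\<close>

lemma face_chain_bounded:
  fixes C :: "'a::euclidean_space set"
  assumes "convex C" "face_chain C k F"
  shows "k \<le> Suc DIM('a)"
proof -
  have "int i \<le> aff_dim (F (Suc i))" if "Suc i \<le> k" for i
    using that
  proof (induction i)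
    case 0
    then have "F (Suc 0) \<noteq> {}" using assms(2) by (auto simp: face_chain_def)
    then show ?case using aff_dim_negative_iff[of "F (Suc 0)"] by linarith
  next
    case (Suc i)
    have f: "F (Suc i) face_of C" "F (Suc (Suc i)) face_of C" "F (Suc i) \<subset> F (Suc (Suc i))"
      using assms(2) Suc.prems by (auto simp: face_chain_def)
    then have "F (Suc i) face_of F (Suc (Suc i))"
      by (meson face_of_imp_subset face_of_subset psubset_imp_subset)
    then have "aff_dim (F (Suc i)) < aff_dim (F (Suc (Suc i)))"
      using f by (intro face_of_aff_dim_lt) (auto dest: face_of_imp_convex)
    then show ?case using Suc by auto
  qed
  from this[of "k - 1"] show ?thesis
    using aff_dim_le_DIM[of "F k"] by (cases k) force+
qed

lemma max_face_chain:
  fixes C :: "'a::euclidean_space set"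
  assumes "convex C"
  shows "\<exists>F. face_chain C (max_face_chain C) F"
    and "face_chain C k F \<Longrightarrow> k \<le> max_face_chain C"
proof -
  have "\<exists>F. face_chain C 0 F" by (simp add: face_chain_def)
  then show "\<exists>F. face_chain C (max_face_chain C) F"
    unfolding max_face_chain_def
    by (rule GreatestI_nat[where b = "Suc DIM('a)"]) (use assms face_chain_bounded in blast)
  show "k \<le> max_face_chain C" if "face_chain C k F"
    unfolding max_face_chain_def
    by (rule Greatest_le_nat[where b = "Suc DIM('a)"]) (use that assms face_chain_bounded in blast)+
qed

text \<open>Strong infeasibility agrees with its definition for any primal or dual representation
  of \<open>H\<close>.\<close>

lemma strongly_infeasible_primal_form:
  fixes A :: "'b::euclidean_space \<Rightarrow> 'a::euclidean_space"
  assumes "linear A" and "H = {b - A x |x. True}"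
  shows "strongly_infeasible H K \<longleftrightarrow>
    (\<exists>y\<in>dual_cone K. adjoint A y = 0 \<and> b \<bullet> y = -1)"
proof -
  have "(\<forall>h\<in>H. y \<bullet> h = -1) \<longleftrightarrow> adjoint A y = 0 \<and> b \<bullet> y = -1" for y
  proof
    assume h: "\<forall>h\<in>H. y \<bullet> h = -1"
    have "y \<bullet> (b - A 0) = -1"
      using h unfolding assms(2) by blast
    then have b: "b \<bullet> y = -1"
      using linear_0[OF assms(1)] by (simp add: inner_commute)
    have "y \<bullet> (b - A (adjoint A y)) = -1"
      using h unfolding assms(2) by blast
    then have "adjoint A y \<bullet> adjoint A y = 0"
      using b by (simp add: adjoint_works[OF assms(1)] inner_diff_right inner_commute)
    with b show "adjoint A y = 0 \<and> b \<bullet> y = -1" by simp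
  next
    assume y: "adjoint A y = 0 \<and> b \<bullet> y = -1"
    then have "y \<bullet> A x = 0" for x
      using adjoint_works[OF assms(1), of x y] by (simp add: inner_commute)
    with y show "\<forall>h\<in>H. y \<bullet> h = -1"
      unfolding assms(2) by (auto simp: inner_diff_right inner_commute)
  qed
  then show ?thesis by (simp add: strongly_infeasible_def)
qed

lemma strongly_infeasible_dual_form:
  fixes A :: "'b::euclidean_space \<Rightarrow> 'a::euclidean_space"
  assumes "linear A" and "H = {y. adjoint A y = c}" and "H \<noteq> {}"
  shows "strongly_infeasible H K \<longleftrightarrow> (\<exists>x. A x \<in> dual_cone K \<and> c \<bullet> x = -1)"
proof
  assume "\<exists>x. A x \<in> dual_cone K \<and> c \<bullet> x = -1"
  then obtain x where x: "A x \<in> dual_cone K" "c \<bullet> x = -1" by blast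
  have "A x \<bullet> h = -1" if "h \<in> H" for h
  proof -
    have "h \<bullet> A x = adjoint A h \<bullet> x" using adjoint_works[OF assms(1), of x h] by (simp add: inner_commute)
    also have "adjoint A h = c" using that assms(2) by simp
    finally show ?thesis using x by (simp add: inner_commute)
  qed
  with x show "strongly_infeasible H K" by (auto simp: strongly_infeasible_def)
next
  assume "strongly_infeasible H K"
  then obtain y where y: "y \<in> dual_cone K" "\<And>h. h \<in> H \<Longrightarrow> y \<bullet> h = -1"
    by (auto simp: strongly_infeasible_def)
  obtain h where h: "adjoint A h = c" using assms by auto
  have ladj: "linear (adjoint A)" by (rule adjoint_linear[OF assms(1)])
  obtain u v where u: "u \<in> span (range A)" and v: "\<And>w. w \<in> span (range A) \<Longrightarrow> orthogonal v w"
    and uv: "y = u + v"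
    using orthogonal_subspace_decomp_exists[of "range A" y] by blast
  have "v \<bullet> A (adjoint A v) = 0"
    using v[OF span_base] by (auto simp: orthogonal_def)
  then have "adjoint A v \<bullet> adjoint A v = 0"
    using adjoint_works[OF assms(1), of "adjoint A v" v] by (simp add: inner_commute)
  then have "adjoint A v = 0" by simp
  then have "adjoint A (h + v) = c" using h by (simp add: linear_add[OF ladj])
  then have "y \<bullet> (h + v) = -1" "y \<bullet> h = -1" using y(2) h assms(2) by auto
  then have "y \<bullet> v = 0" by (simp add: inner_add_right)
  moreover have "u \<bullet> v = 0" using v[OF u] by (simp add: orthogonal_def inner_commute)
  ultimately have "v \<bullet> v = 0" by (simp add: uv inner_add_left)
  then have "v = 0" by simp
  then have "y \<in> span (range A)" using u uv by simp
  then obtain x where x: "y = A x"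
    using linear_subspace_image[OF assms(1) subspace_UNIV] by (auto simp: span_eq_iff[THEN iffD2])
  have "c \<bullet> x = -1"
    using adjoint_works[OF assms(1), of x h] h x \<open>y \<bullet> h = -1\<close> by (simp add: inner_commute)
  with x y show "\<exists>x. A x \<in> dual_cone K \<and> c \<bullet> x = -1" by auto
qed

end

theory Submission
  imports Defs
begin

text \<open>
  Part (1) is facial reduction. If \<open>H\<close> misses the cone \<open>K\<close>, properly separate the two: some \<open>a\<close> in
  the dual cone is constant on \<open>H\<close> with value at most \<open>0\<close>. If that value is negative, then
  the whole hyperplane on which \<open>a\<close> takes it misses \<open>K\<close>, and it contains \<open>H\<close>. If the value is \<open>0\<close>, then
  properness makes \<open>K \<inter> {x. a \<bullet> x = 0}\<close> a proper face of \<open>K\<close>, which \<open>H\<close> also misses. Recursing into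
  this face costs one hyperplane, hence at most one unit of codimension, while every chain of faces
  of this face is extended by \<open>K\<close> itself, so the codimension never exceeds \<open>max_face_chain K\<close>
  (\<open>infeasible_superspace_of_small_codim\<close>).

  Part (2) is part (1) for the dual cone. The certificates of strong infeasibility of \<open>H\<close> are the
  points of the dual cone in the affine set \<open>affine_polar H\<close> of functionals equal to \<open>-1\<close> on \<open>H\<close>.
  On affine subspaces that avoid the origin, \<open>affine_polar\<close> is an order-reversing involution which
  turns codimension \<open>k\<close> into dimension \<open>k - 1\<close>. So a superspace of \<open>affine_polar H\<close> of small
  codimension that misses the dual cone is itself the polar of a subspace of \<open>H\<close> of small dimension
  without certificates. If the origin lies in \<open>H\<close>, it is such a subspace by itself.

  For part (3), enlarging \<open>H\<close> only removes certificates and shrinking \<open>H\<close> only removes feasible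
  points, so the two subspaces constructed before are automatically weakly infeasible.
\<close>

section \<open>Chains of faces\<close>

lemma max_face_chain_pos:
  fixes C :: "'a::euclidean_space set"
  assumes "convex C" "C \<noteq> {}"
  shows "1 \<le> max_face_chain C"
proof -
  have "face_chain C 1 (\<lambda>_. C)"
    using assms by (simp add: face_chain_def face_of_refl)
  then show ?thesis
    using max_face_chain(2)[OF assms(1)] by blast
qed

text \<open>A chain of faces of a proper face stays a chain of faces of the whole set, and the set itself
  can be appended at its top.\<close>

lemma max_face_chain_proper_face:
  fixes C :: "'a::euclidean_space set"
  assumes "convex C" "D face_of C" "D \<noteq> C"
  shows "max_face_chain D < max_face_chain C"
proof -
  have "convex D"
    using assms(2) by (rule face_of_imp_convex)
  then obtain F where F: "face_chain D (max_face_chain D) F"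
    using max_face_chain(1) by blast
  let ?k = "max_face_chain D"
  have DC: "D \<subset> C"
    using assms face_of_imp_subset by blast
  have FD: "F i \<subseteq> D" "F i face_of C" "F i \<noteq> {}" if "i \<in> {1..?k}" for i
  proof -
    show "F i \<noteq> {}"
      using F that unfolding face_chain_def by blast
    have "F i face_of D"
      using F that unfolding face_chain_def by blast
    then show "F i \<subseteq> D" "F i face_of C"
      using face_of_imp_subset face_of_trans[OF _ assms(2)] by auto
  qed
  have "face_chain C (Suc ?k) (F(Suc ?k := C))"
    unfolding face_chain_def
  proof (intro conjI ballI)
    fix i assume "i \<in> {1..Suc ?k}"
    then consider "i = Suc ?k" | "i \<in> {1..?k}" "i \<noteq> Suc ?k"
      by fastforce
    then have "(F(Suc ?k := C)) i face_of C \<and> (F(Suc ?k := C)) i \<noteq> {}"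
    proof cases
      case 1
      then show ?thesis using face_of_refl[OF assms(1)] DC by auto
    next
      case 2
      then show ?thesis using FD(2,3)[of i] by simp
    qed
    then show "(F(Suc ?k := C)) i face_of C" "(F(Suc ?k := C)) i \<noteq> {}"
      by blast+
  next
    fix i assume i: "i \<in> {1..<Suc ?k}"
    show "(F(Suc ?k := C)) i \<subset> (F(Suc ?k := C)) (Suc i)"
    proof (cases "i = ?k")
      case True
      then show ?thesis using FD(1)[of i] i DC by auto
    next
      case False
      then show ?thesis using F i by (auto simp: face_chain_def)
    qed
  qed
  then have "Suc ?k \<le> max_face_chain C"
    by (rule max_face_chain(2)[OF assms(1)])
  then show ?thesis by simp
qed

section \<open>Separating an affine set from a cone\<close>

text \<open>A linear functional takes every real value along a line on which it is not constant.\<close>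

lemma inner_constant_on_affine:
  fixes S :: "'a::real_inner set"
  assumes "affine S" and bound: "\<And>x. x \<in> S \<Longrightarrow> a \<bullet> x \<le> b" and "x \<in> S" "y \<in> S"
  shows "a \<bullet> x = a \<bullet> y"
proof (rule ccontr)
  assume ne: "a \<bullet> x \<noteq> a \<bullet> y"
  \<comment> \<open>The parameter at which the functional takes the value \<open>b + 1\<close> on the line through \<open>x\<close> and \<open>y\<close>.\<close>
  define t where "t = (b + 1 - a \<bullet> x) / (a \<bullet> y - a \<bullet> x)"
  have "(1 - t) *\<^sub>R x + t *\<^sub>R y \<in> S"
    using assms by (intro mem_affine) auto
  moreover have "a \<bullet> ((1 - t) *\<^sub>R x + t *\<^sub>R y) = a \<bullet> x + t * (a \<bullet> y - a \<bullet> x)"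
    by (simp add: inner_add_right algebra_simps)
  moreover have "t * (a \<bullet> y - a \<bullet> x) = b + 1 - a \<bullet> x"
    using ne by (simp add: t_def)
  ultimately show False
    using bound by fastforce
qed

text \<open>The separating functional is chosen in the span of the difference set \<open>C - H\<close>, hence cannot
  vanish on all of it; this is what makes the separation proper.\<close>

lemma separate_affine_from_cone:
  fixes C H :: "'a::euclidean_space set"
  assumes "convex_cone C" "affine_subspace H" "H \<inter> C = {}"
  obtains a \<alpha> where "a \<in> dual_cone C" "\<And>h. h \<in> H \<Longrightarrow> a \<bullet> h = \<alpha>" "\<alpha> \<le> 0"
    "\<alpha> = 0 \<Longrightarrow> \<exists>c\<in>C. a \<bullet> c \<noteq> 0"
proof -
  have H: "affine H" "H \<noteq> {}"
    using assms(2) by (auto simp: affine_subspace_def)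
  have C: "convex C" "C \<noteq> {}" "0 \<in> C"
    using assms(1) by (auto simp: convex_cone_def intro: convex_cone_contains_0[OF assms(1)])
  define S where "S = (\<Union>c\<in>C. \<Union>h\<in>H. {c - h})"
  have "convex S"
    unfolding S_def using C(1) affine_imp_convex[OF H(1)] by (rule convex_differences)
  moreover have "S \<noteq> {}" "0 \<notin> S"
    using assms(3) C H by (auto simp: S_def)
  ultimately obtain a where a: "a \<in> span S" "a \<noteq> 0" "\<And>x. x \<in> S \<Longrightarrow> 0 \<le> a \<bullet> x"
    using separating_hyperplane_set_0_inspan[of S] by metis
  have le: "a \<bullet> h \<le> a \<bullet> c" if "c \<in> C" "h \<in> H" for c h
    using a(3)[of "c - h"] that by (auto simp: S_def inner_diff_right)
  obtain h0 where h0: "h0 \<in> H"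
    using H by blast
  have const: "a \<bullet> h = a \<bullet> h0" if "h \<in> H" for h
    using inner_constant_on_affine[OF H(1) _ that h0, of a 0] le[OF C(3)] by simp
  have "0 \<le> a \<bullet> c" if "c \<in> C" for c
  proof (rule ccontr)
    assume neg: "\<not> 0 \<le> a \<bullet> c"
    \<comment> \<open>Rescaling \<open>c\<close> pushes the functional below its value on \<open>H\<close>.\<close>
    define t where "t = (a \<bullet> h0 - 1) / (a \<bullet> c)"
    have "a \<bullet> h0 \<le> 0"
      using le[OF C(3) h0] by simp
    then have "0 \<le> t"
      using neg by (simp add: t_def divide_nonpos_neg)
    then have "a \<bullet> h0 \<le> a \<bullet> (t *\<^sub>R c)"
      by (intro le h0 convex_cone_scaleR[OF assms(1)] that)
    then show False
      using neg by (simp add: t_def)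
  qed
  then have "a \<in> dual_cone C"
    by (simp add: dual_cone_def)
  moreover have "\<exists>c\<in>C. a \<bullet> c \<noteq> 0" if "a \<bullet> h0 = 0"
  proof (rule ccontr)
    assume "\<not> (\<exists>c\<in>C. a \<bullet> c \<noteq> 0)"
    moreover have "a \<bullet> h = 0" if "h \<in> H" for h
      using const[OF that] \<open>a \<bullet> h0 = 0\<close> by (rule trans)
    ultimately have "orthogonal a x" if "x \<in> S" for x
      using that by (auto simp: S_def orthogonal_def inner_diff_right)
    then have "orthogonal a a"
      using orthogonal_to_span a(1) by blast
    then show False
      using a(2) by (simp add: orthogonal_def)
  qed
  ultimately show thesis
    using that[OF _ const] le[OF C(3) h0] by (metis inner_zero_right)
qed

section \<open>Facial reduction\<close>

lemma codim_Int_hyperplane: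
  fixes S :: "'a::euclidean_space set"
  assumes "affine S" "S \<inter> {x. a \<bullet> x = b} \<noteq> {}"
  shows "codim (S \<inter> {x. a \<bullet> x = b}) \<le> codim S + 1"
  using assms by (auto simp: codim_def aff_dim_affine_Int_hyperplane)

text \<open>The induction runs over all cones at once, because the reduction step replaces \<open>C\<close> by a proper
  face of it and keeps \<open>H\<close>.\<close>

lemma infeasible_superspace_of_small_codim:
  fixes C H :: "'a::euclidean_space set"
  assumes "convex_cone C" "affine_subspace H" "H \<inter> C = {}"
  shows "\<exists>H'. affine_subspace H' \<and> H \<subseteq> H' \<and> codim H' \<le> int (max_face_chain C) \<and> H' \<inter> C = {}"
  using assms(1,3)
proof (induction "max_face_chain C" arbitrary: C rule: less_induct)
  case less
  have C: "convex C" "C \<noteq> {}" "0 \<in> C"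
    using less.prems(1) by (auto simp: convex_cone_def intro: convex_cone_contains_0)
  have H: "H \<noteq> {}"
    using assms(2) by (simp add: affine_subspace_def)
  obtain a \<alpha> where a: "a \<in> dual_cone C" "\<And>h. h \<in> H \<Longrightarrow> a \<bullet> h = \<alpha>" "\<alpha> \<le> 0"
      "\<alpha> = 0 \<Longrightarrow> \<exists>c\<in>C. a \<bullet> c \<noteq> 0"
    using separate_affine_from_cone[OF less.prems(1) assms(2) less.prems(2)] by blast
  have nonneg: "0 \<le> a \<bullet> c" if "c \<in> C" for c
    using a(1) that by (simp add: dual_cone_def)
  show ?case
  proof (cases "\<alpha> = 0")
    case False
    let ?H' = "{x. a \<bullet> x = \<alpha>}"
    have "a \<noteq> 0"
      using False a(2) H by force
    then have "codim ?H' = 1"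
      by (simp add: codim_def)
    moreover have "affine_subspace ?H'" "H \<subseteq> ?H'"
      using a(2) H by (auto simp: affine_subspace_def affine_hyperplane)
    moreover have "?H' \<inter> C = {}"
      using nonneg a(3) False by fastforce
    ultimately show ?thesis
      using max_face_chain_pos[OF C(1,2)] by (intro exI[of _ ?H']) simp
  next
    case True
    define D where "D = C \<inter> {x. a \<bullet> x = 0}"
    have "D face_of C"
      unfolding D_def using C nonneg by (intro face_of_Int_supporting_hyperplane_ge) auto
    moreover have "D \<noteq> C"
      using a(4)[OF True] by (auto simp: D_def)
    ultimately have lt: "max_face_chain D < max_face_chain C"
      using max_face_chain_proper_face C(1) by blast
    have "convex_cone D"
      using less.prems(1) by (auto simp: D_def convex_cone_iff inner_add_right)
    moreover have "H \<inter> D = {}"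
      using less.prems(2) by (auto simp: D_def)
    ultimately obtain H1 where H1: "affine_subspace H1" "H \<subseteq> H1"
        "codim H1 \<le> int (max_face_chain D)" "H1 \<inter> D = {}"
      using less.hyps[OF lt] by blast
    let ?H' = "H1 \<inter> {x. a \<bullet> x = 0}"
    have sub: "H \<subseteq> ?H'"
      using H1(2) a(2) True by auto
    have "affine_subspace ?H'"
      using H1(1) sub H by (auto simp: affine_subspace_def affine_hyperplane intro: affine_Int)
    moreover have "codim ?H' \<le> int (max_face_chain C)"
    proof -
      have "codim ?H' \<le> codim H1 + 1"
        using H1(1) sub H by (intro codim_Int_hyperplane) (auto simp: affine_subspace_def)
      then show ?thesis
        using H1(3) lt by linarith
    qed
    moreover have "?H' \<inter> C = {}"
      using H1(4) by (auto simp: D_def)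
    ultimately show ?thesis
      using sub by blast
  qed
qed

section \<open>Polars of affine subspaces\<close>

text \<open>The value \<open>-1\<close> is the normalisation of certificates of strong infeasibility.\<close>

definition affine_polar :: "'a::real_inner set \<Rightarrow> 'a set" where
  "affine_polar S = {y. \<forall>x\<in>S. y \<bullet> x = -1}"

lemma strongly_infeasible_iff_affine_polar:
  "strongly_infeasible H K \<longleftrightarrow> affine_polar H \<inter> dual_cone K \<noteq> {}"
  by (auto simp: strongly_infeasible_def affine_polar_def)

lemma affine_polar_antimono: "S \<subseteq> T \<Longrightarrow> affine_polar T \<subseteq> affine_polar S"
  by (auto simp: affine_polar_def)

lemma affine_affine_polar: "affine (affine_polar S)"
proof -
  have "affine_polar S = \<Inter> ((\<lambda>x. {y. x \<bullet> y = -1}) ` S)"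
    by (auto simp: affine_polar_def inner_commute)
  then show ?thesis
    by (auto intro!: affine_Inter simp: affine_hyperplane)
qed

lemma zero_notin_affine_polar: "S \<noteq> {} \<Longrightarrow> 0 \<notin> affine_polar S"
  by (auto simp: affine_polar_def)

text \<open>Strictly separating the origin from the affine set gives a functional that is constant and
  positive there, and rescaling makes the constant \<open>-1\<close>.\<close>

lemma affine_polar_nonempty:
  fixes S :: "'a::euclidean_space set"
  assumes "affine S" "0 \<notin> S"
  shows "affine_polar S \<noteq> {}"
proof (cases "S = {}")
  case True
  then show ?thesis by (simp add: affine_polar_def)
next
  case False
  then obtain s where s: "s \<in> S" by blast
  obtain a b where ab: "0 < b" "\<And>x. x \<in> S \<Longrightarrow> b < a \<bullet> x"
    using separating_hyperplane_closed_point[of S 0] assms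
    by (auto simp: affine_imp_convex affine_closed)
  have const: "a \<bullet> x = a \<bullet> s" if "x \<in> S" for x
    using inner_constant_on_affine[OF assms(1), of "- a" "- b" x s] ab(2) that s
    by (force intro: less_imp_le)
  have "a \<bullet> s \<noteq> 0"
    using ab s by fastforce
  then have "(- 1 / (a \<bullet> s)) *\<^sub>R a \<in> affine_polar S"
    unfolding affine_polar_def by (auto dest: const)
  then show ?thesis by blast
qed

text \<open>The polar is a translate of the orthogonal complement of the span of \<open>S\<close>, and that span has one
  dimension more than \<open>S\<close> because \<open>S\<close> avoids the origin.\<close>

lemma aff_dim_affine_polar:
  fixes S :: "'a::euclidean_space set"
  assumes "affine S" "0 \<notin> S"
  shows "aff_dim (affine_polar S) = int DIM('a) - 1 - aff_dim S"
proof -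
  obtain y0 where y0: "y0 \<in> affine_polar S"
    using affine_polar_nonempty[OF assms] by blast
  define N where "N = {y. \<forall>x\<in>span S. orthogonal x y}"
  have N: "N = {y. \<forall>x\<in>S. orthogonal x y}"
  proof (intro equalityI subsetI CollectI ballI)
    fix y x assume "y \<in> N" "x \<in> S"
    then show "orthogonal x y"
      by (simp add: N_def span_base)
  next
    fix y assume "y \<in> {y. \<forall>x\<in>S. orthogonal x y}"
    then show "y \<in> N"
      unfolding N_def using orthogonal_to_span[of _ S y] by (simp add: orthogonal_commute)
  qed
  have "affine_polar S = (+) y0 ` N"
  proof (intro equalityI subsetI)
    fix y assume "y \<in> affine_polar S"
    then have "y - y0 \<in> N"
      using y0 by (auto simp: N affine_polar_def orthogonal_def inner_diff_right inner_commute)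
    then show "y \<in> (+) y0 ` N"
      by (intro image_eqI[of _ _ "y - y0"]) simp_all
  next
    fix y assume "y \<in> (+) y0 ` N"
    then show "y \<in> affine_polar S"
      using y0
      by (auto simp: N affine_polar_def orthogonal_def inner_add_left inner_add_right inner_commute)
  qed
  then have "aff_dim (affine_polar S) = aff_dim N"
    by (simp add: aff_dim_translation_eq)
  also have "\<dots> = int (dim N)"
    by (rule aff_dim_zero) (auto simp: N_def orthogonal_def intro: hull_inc)
  also have "\<dots> = int DIM('a) - int (dim S)"
    using dim_subspace_orthogonal_to_vectors[of "span S" UNIV] by (simp add: N_def)
  also have "int (dim S) = aff_dim (insert 0 S)"
    using aff_dim_zero[of "insert 0 S"] by (simp add: hull_inc dim_insert span_zero)
  also have "\<dots> = aff_dim S + 1"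
    using assms by (simp add: aff_dim_insert hull_same)
  finally show ?thesis by simp
qed

text \<open>Taking the polar twice restores the dimension, so the evident inclusion is an equality.\<close>

lemma affine_polar_affine_polar:
  fixes S :: "'a::euclidean_space set"
  assumes "affine_subspace S" "0 \<notin> S"
  shows "affine_polar (affine_polar S) = S"
proof -
  have S: "affine S" "S \<noteq> {}"
    using assms(1) by (auto simp: affine_subspace_def)
  have "aff_dim S = aff_dim (affine_polar (affine_polar S))"
    using S assms(2) by (simp add: aff_dim_affine_polar affine_affine_polar zero_notin_affine_polar)
  moreover have "S \<subseteq> affine_polar (affine_polar S)"
    by (auto simp: affine_polar_def inner_commute)
  ultimately show ?thesis
    using affine_dim_equal[OF S(1) affine_affine_polar S(2)] by metis
qed

section \<open>Dualization\<close>

lemma convex_cone_dual_cone: "convex_cone (dual_cone K)"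
  by (simp add: convex_cone_iff dual_cone_def inner_add_left)

text \<open>Facial reduction for the dual cone, applied to the set of certificate candidates
  \<open>affine_polar H\<close>. If the origin lies in \<open>H\<close>, there are no candidates, and the origin alone is a
  subspace without certificates.\<close>

lemma subspace_of_small_dim_not_strongly_infeasible:
  fixes K H :: "'a::euclidean_space set"
  assumes "affine_subspace H" "\<not> strongly_infeasible H K"
  shows "\<exists>H''. affine_subspace H'' \<and> H'' \<subseteq> H
    \<and> aff_dim H'' \<le> int (max_face_chain (dual_cone K)) - 1 \<and> \<not> strongly_infeasible H'' K"
proof (cases "0 \<in> H")
  case True
  have "1 \<le> max_face_chain (dual_cone K)"
    using convex_cone_dual_cone[of K] by (intro max_face_chain_pos) (auto simp: convex_cone_def)
  moreover have "\<not> strongly_infeasible {0} K"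
    by (simp add: strongly_infeasible_def)
  ultimately show ?thesis
    using True by (intro exI[of _ "{0}"]) (simp add: affine_subspace_def)
next
  case False
  have H: "affine H" "H \<noteq> {}"
    using assms(1) by (auto simp: affine_subspace_def)
  have "affine_subspace (affine_polar H)"
    using affine_affine_polar affine_polar_nonempty[OF H(1) False] by (simp add: affine_subspace_def)
  moreover have "affine_polar H \<inter> dual_cone K = {}"
    using assms(2) by (simp add: strongly_infeasible_iff_affine_polar)
  ultimately obtain M where M: "affine_subspace M" "affine_polar H \<subseteq> M"
      "codim M \<le> int (max_face_chain (dual_cone K))" "M \<inter> dual_cone K = {}"
    using infeasible_superspace_of_small_codim[OF convex_cone_dual_cone] by blast
  have M0: "affine M" "0 \<notin> M"
    using M(1,4) convex_cone_contains_0[OF convex_cone_dual_cone] by (auto simp: affine_subspace_def)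
  have "affine_subspace (affine_polar M)"
    using affine_affine_polar affine_polar_nonempty[OF M0] by (simp add: affine_subspace_def)
  moreover have "affine_polar M \<subseteq> H"
    using affine_polar_antimono[OF M(2)] affine_polar_affine_polar[OF assms(1) False] by simp
  moreover have "aff_dim (affine_polar M) \<le> int (max_face_chain (dual_cone K)) - 1"
    using M(3) by (simp add: aff_dim_affine_polar[OF M0] codim_def)
  moreover have "\<not> strongly_infeasible (affine_polar M) K"
    using M(4) affine_polar_affine_polar[OF M(1) M0(2)]
    by (simp add: strongly_infeasible_iff_affine_polar)
  ultimately show ?thesis by blast
qed

lemma strongly_infeasible_antimono:
  fixes H H' K :: "'a::real_inner set"
  shows "strongly_infeasible H' K \<Longrightarrow> H \<subseteq> H' \<Longrightarrow> strongly_infeasible H K"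
  by (auto simp: strongly_infeasible_def)

section \<open>Small certificates of infeasibility\<close>

theorem corollary1:
  fixes K H :: "'a::euclidean_space set"
  assumes "closed K" and "convex_cone K" and "affine_subspace H"
  shows "(H \<inter> K = {} \<longrightarrow>
      (\<exists>H'. affine_subspace H' \<and> H \<subseteq> H' \<and> codim H' \<le> int (max_face_chain K)
         \<and> H' \<inter> K = {}))
    \<and> (\<not> strongly_infeasible H K \<longrightarrow>
      (\<exists>H''. affine_subspace H'' \<and> H'' \<subseteq> H
         \<and> aff_dim H'' \<le> int (max_face_chain (dual_cone K)) - 1
         \<and> \<not> strongly_infeasible H'' K))
    \<and> (weakly_infeasible H K \<longrightarrow>
      (\<exists>H' H''. affine_subspace H' \<and> affine_subspace H'' \<and> H'' \<subseteq> H \<and> H \<subseteq> H'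
         \<and> codim H' \<le> int (max_face_chain K)
         \<and> aff_dim H'' \<le> int (max_face_chain (dual_cone K)) - 1
         \<and> weakly_infeasible H' K \<and> weakly_infeasible H'' K))"
proof (intro conjI impI)
  assume "H \<inter> K = {}"
  then show "\<exists>H'. affine_subspace H' \<and> H \<subseteq> H' \<and> codim H' \<le> int (max_face_chain K)
      \<and> H' \<inter> K = {}"
    by (rule infeasible_superspace_of_small_codim[OF assms(2,3)])
next
  assume "\<not> strongly_infeasible H K"
  then show "\<exists>H''. affine_subspace H'' \<and> H'' \<subseteq> H
      \<and> aff_dim H'' \<le> int (max_face_chain (dual_cone K)) - 1
      \<and> \<not> strongly_infeasible H'' K"
    by (rule subspace_of_small_dim_not_strongly_infeasible[OF assms(3)])
next
  assume "weakly_infeasible H K"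
  then have H: "H \<inter> K = {}" "\<not> strongly_infeasible H K"
    by (auto simp: weakly_infeasible_def)
  obtain H' where H': "affine_subspace H'" "H \<subseteq> H'" "codim H' \<le> int (max_face_chain K)"
      "H' \<inter> K = {}"
    using infeasible_superspace_of_small_codim[OF assms(2,3) H(1)] by blast
  obtain H'' where H'': "affine_subspace H''" "H'' \<subseteq> H"
      "aff_dim H'' \<le> int (max_face_chain (dual_cone K)) - 1" "\<not> strongly_infeasible H'' K"
    using subspace_of_small_dim_not_strongly_infeasible[OF assms(3) H(2)] by blast
  have "weakly_infeasible H' K"
    using H'(2,4) H(2) strongly_infeasible_antimono unfolding weakly_infeasible_def by blast
  moreover have "weakly_infeasible H'' K"
    using H''(2,4) H(1) by (auto simp: weakly_infeasible_def)
  ultimately show "\<exists>H' H''. affine_subspace H' \<and> affine_subspace H'' \<and> H'' \<subseteq> H \<and> H \<subseteq> H'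
      \<and> codim H' \<le> int (max_face_chain K)
      \<and> aff_dim H'' \<le> int (max_face_chain (dual_cone K)) - 1
      \<and> weakly_infeasible H' K \<and> weakly_infeasible H'' K"
    using H'(1-3) H''(1-3) by (intro exI[of _ H'] exI[of _ H''] conjI)
qed

end
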